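(* Let $A$ and $H$ be abelian groups, and let $G=A\rtimes_{\alpha}H$ be a semidirect product, where $\alpha\colon H\to\operatorname{Aut}(A)$ denotes the action. For every semiminimal family $C$ of $G$, we have $$\chi(\operatorname{Cay}(G,C))\le 4\,|\alpha(H)|.$$
   Context: A semiminimal family of a group $G$ is a family $C=(c_\beta)_{\beta<\iota}$ of elements of $G$ indexed by an ordinal $\iota$ (not necessarily generating $G$) such that $c_\beta\notin\langle c_\gamma:\gamma<\beta\rangle$ for every $\beta<\iota$. For a group $G$ and a family $C$ of elements of $G$, the undirected Cayley graph $\operatorname{Cay}(G,C)$ has vertex set $G$, with two distinct elements $a,b$ adjacent whenever $a^{-1}b\in C\cup C^{-1}$. $\chi(X)$ denotes the chromatic number, the minimum number (cardinal) of colors in a proper vertex coloring of $X$. $|\alpha(H)|$ is the cardinality of the image of $\alpha$, and the product is a product of cardinals. *)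

theory Defs
  imports "HOL-Algebra.Bij" "HOL-Algebra.Generated_Groups"
begin

unbundle cardinal_syntax

section \<open>Semidirect products\<close>

definition semidirect_product ::
  "('a, 'm) monoid_scheme \<Rightarrow> ('h, 'n) monoid_scheme \<Rightarrow> ('h \<Rightarrow> 'a \<Rightarrow> 'a) \<Rightarrow> ('a \<times> 'h) monoid"
  where "semidirect_product A H \<alpha> =
    \<lparr>carrier = carrier A \<times> carrier H,
     mult = (\<lambda>(a, h) (b, k). (a \<otimes>\<^bsub>A\<^esub> \<alpha> h b, h \<otimes>\<^bsub>H\<^esub> k)),
     one = (\<one>\<^bsub>A\<^esub>, \<one>\<^bsub>H\<^esub>)\<rparr>"

lemma group_semidirect_product:
  assumes "group A" "group H" "\<alpha> \<in> hom H (AutoGroup A)"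
  shows "group (semidirect_product A H \<alpha>)"
proof -
  interpret A: group A by fact
  interpret H: group H by fact
  have auto: "\<alpha> h \<in> hom A A" "\<alpha> h \<in> Bij (carrier A)" if "h \<in> carrier H" for h
    using hom_in_carrier[OF assms(3) that] by (auto simp: AutoGroup_def auto_def)
  have closed: "\<alpha> h a \<in> carrier A" if "h \<in> carrier H" "a \<in> carrier A" for h a
    using auto[OF that(1)] that(2) by (auto simp: hom_def)
  have mult: "\<alpha> h (a \<otimes>\<^bsub>A\<^esub> b) = \<alpha> h a \<otimes>\<^bsub>A\<^esub> \<alpha> h b"
    if "h \<in> carrier H" "a \<in> carrier A" "b \<in> carrier A" for h a b
    using auto[OF that(1)] that by (auto simp: hom_def)
  have comp: "\<alpha> (h \<otimes>\<^bsub>H\<^esub> k) a = \<alpha> h (\<alpha> k a)"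
    if "h \<in> carrier H" "k \<in> carrier H" "a \<in> carrier A" for h k a
    using hom_mult[OF assms(3) that(1,2)] auto that
    by (simp add: AutoGroup_def BijGroup_def compose_eq)
  have "group (AutoGroup A)" by (rule A.AutoGroup)
  hence one: "\<alpha> \<one>\<^bsub>H\<^esub> a = a" if "a \<in> carrier A" for a
    using hom_one[OF assms(3) assms(2)] that by (simp add: AutoGroup_def BijGroup_def)
  show ?thesis
  proof (rule groupI)
    fix x assume "x \<in> carrier (semidirect_product A H \<alpha>)"
    then obtain a h where x: "x = (a, h)" "a \<in> carrier A" "h \<in> carrier H"
      by (auto simp: semidirect_product_def)
    let ?y = "(\<alpha> (inv\<^bsub>H\<^esub> h) (inv\<^bsub>A\<^esub> a), inv\<^bsub>H\<^esub> h)"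
    have "\<alpha> (inv\<^bsub>H\<^esub> h) (inv\<^bsub>A\<^esub> a) \<otimes>\<^bsub>A\<^esub> \<alpha> (inv\<^bsub>H\<^esub> h) a = \<one>\<^bsub>A\<^esub>"
      using mult[of "inv\<^bsub>H\<^esub> h" "inv\<^bsub>A\<^esub> a" a] x auto(1)[of "inv\<^bsub>H\<^esub> h"]
      by (simp add: hom_one[OF _ A.is_group A.is_group])
    thus "\<exists>y \<in> carrier (semidirect_product A H \<alpha>).
        y \<otimes>\<^bsub>semidirect_product A H \<alpha>\<^esub> x = \<one>\<^bsub>semidirect_product A H \<alpha>\<^esub>"
      using x closed by (intro bexI[of _ ?y]) (auto simp: semidirect_product_def)
  qed (auto simp: semidirect_product_def closed mult comp one A.m_assoc H.m_assoc)
qed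

section \<open>Semiminimal families\<close>

text \<open>
  The index ordinal is represented by an arbitrary well-order \<open>r\<close> (reflexive on its field);
  the indices are the elements of \<open>Field r\<close>, and \<open>underS r \<beta>\<close> is the set of all indices
  strictly below \<open>\<beta>\<close>.
\<close>

definition semiminimal_family ::
  "('g, 'm) monoid_scheme \<Rightarrow> 'i rel \<Rightarrow> ('i \<Rightarrow> 'g) \<Rightarrow> bool"
  where "semiminimal_family G r c \<longleftrightarrow>
    Well_order r \<and>
    c ` Field r \<subseteq> carrier G \<and>
    (\<forall>\<beta> \<in> Field r. c \<beta> \<notin> generate G (c ` underS r \<beta>))"

section \<open>Graphs, Cayley graphs and chromatic numbers\<close>

text \<open>
  A graph is a pair of a vertex set and an adjacency relation, the latter being
  symmetric and irreflexive.
\<close>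

type_synonym 'v ugraph = "'v set \<times> 'v rel"

definition cayley_graph :: "('g, 'm) monoid_scheme \<Rightarrow> 'g set \<Rightarrow> 'g ugraph"
  where "cayley_graph G C =
    (carrier G,
     {(a, b). a \<in> carrier G \<and> b \<in> carrier G \<and> a \<noteq> b \<and>
        inv\<^bsub>G\<^esub> a \<otimes>\<^bsub>G\<^esub> b \<in> C \<union> m_inv G ` C})"

lemma irrefl_cayley_graph: "irrefl (snd (cayley_graph G C))"
  by (auto simp: cayley_graph_def irrefl_def)

lemma sym_cayley_graph:
  assumes "group G" "C \<subseteq> carrier G"
  shows "sym (snd (cayley_graph G C))"
proof (rule symI)
  interpret group G by fact
  fix a b assume "(a, b) \<in> snd (cayley_graph G C)"
  hence ab: "a \<in> carrier G" "b \<in> carrier G" "a \<noteq> b"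
    and d: "inv\<^bsub>G\<^esub> a \<otimes>\<^bsub>G\<^esub> b \<in> C \<union> m_inv G ` C"
    by (auto simp: cayley_graph_def)
  have "inv\<^bsub>G\<^esub> b \<otimes>\<^bsub>G\<^esub> a = inv\<^bsub>G\<^esub> (inv\<^bsub>G\<^esub> a \<otimes>\<^bsub>G\<^esub> b)"
    using ab by (simp add: inv_mult_group)
  moreover have "inv\<^bsub>G\<^esub> x \<in> C \<union> m_inv G ` C" if "x \<in> C \<union> m_inv G ` C" for x
    using that assms(2) by (auto simp: subset_iff)
  ultimately have "inv\<^bsub>G\<^esub> b \<otimes>\<^bsub>G\<^esub> a \<in> C \<union> m_inv G ` C" using d by simp
  thus "(b, a) \<in> snd (cayley_graph G C)"
    using ab by (auto simp: cayley_graph_def)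
qed

definition proper_coloring :: "'v ugraph \<Rightarrow> ('v \<Rightarrow> 'c) \<Rightarrow> bool"
  where "proper_coloring X f \<longleftrightarrow> (\<forall>(u, v) \<in> snd X. f u \<noteq> f v)"

text \<open>
  The least cardinal of the form \<open>|f ` V|\<close> for a proper coloring \<open>f\<close>, where \<open>V\<close> is the vertex
  set. For definiteness colors are taken from the type of vertices; this is no restriction,
  see \<open>chromatic_number_le\<close> below, which allows colors of any type. The value is determined
  up to \<open>=o\<close>.
\<close>

definition chromatic_number :: "'v ugraph \<Rightarrow> 'v rel"
  where "chromatic_number X =
    (SOME k. (\<exists>f :: 'v \<Rightarrow> 'v. proper_coloring X f \<and> k = |f ` fst X| ) \<and>
             (\<forall>g :: 'v \<Rightarrow> 'v. proper_coloring X g \<longrightarrow> k \<le>o |g ` fst X| ))"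

lemma chromatic_number_minimum:
  fixes X :: "'v ugraph"
  assumes "irrefl (snd X)"
  shows "(\<exists>f :: 'v \<Rightarrow> 'v. proper_coloring X f \<and> chromatic_number X = |f ` fst X| ) \<and>
    (\<forall>g :: 'v \<Rightarrow> 'v. proper_coloring X g \<longrightarrow> chromatic_number X \<le>o |g ` fst X| )"
proof -
  let ?R = "{|f ` fst X| | f :: 'v \<Rightarrow> 'v. proper_coloring X f}"
  have "proper_coloring X (\<lambda>v. v)"
    using assms by (auto simp: proper_coloring_def irrefl_def)
  hence "?R \<noteq> {}" by blast
  moreover have "\<forall>r \<in> ?R. Card_order r" by (auto simp: card_of_Card_order)
  ultimately obtain k where "k \<in> ?R" "\<forall>r \<in> ?R. k \<le>o r"
    using exists_minim_Card_order[of ?R] by blast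
  hence "(\<exists>f :: 'v \<Rightarrow> 'v. proper_coloring X f \<and> k = |f ` fst X| ) \<and>
    (\<forall>g :: 'v \<Rightarrow> 'v. proper_coloring X g \<longrightarrow> k \<le>o |g ` fst X| )"
    by blast
  thus ?thesis unfolding chromatic_number_def by (rule someI)
qed

lemma chromatic_number_attained:
  fixes X :: "'v ugraph"
  assumes "irrefl (snd X)"
  obtains f :: "'v \<Rightarrow> 'v" where "proper_coloring X f" "chromatic_number X = |f ` fst X|"
  using chromatic_number_minimum[OF assms] by blast

lemma chromatic_number_le:
  fixes X :: "'v ugraph" and g :: "'v \<Rightarrow> 'c"
  assumes "irrefl (snd X)" "snd X \<subseteq> fst X \<times> fst X" "proper_coloring X g"
  shows "chromatic_number X \<le>o |g ` fst X|"
proof -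
  define s where "s = inv_into (fst X) g"
  have "inj_on s (g ` fst X)" unfolding s_def by (rule inj_on_inv_into) simp
  hence "proper_coloring X (s \<circ> g)"
    using assms(2,3) by (fastforce simp: proper_coloring_def dest: inj_onD)
  hence "chromatic_number X \<le>o |(s \<circ> g) ` fst X|"
    using chromatic_number_minimum[OF assms(1)] by blast
  moreover have "|(s \<circ> g) ` fst X| \<le>o |g ` fst X|"
    by (simp only: image_comp[symmetric] card_of_image)
  ultimately show ?thesis by (rule ordLeq_transitive)
qed

end

theory Submission
  imports Defs Complex_Main
begin

text \<open>
  The kernel \<open>N\<close> of the action of \<open>G\<close> on \<open>A\<close> through \<open>H\<close> consists of the pairs \<open>(a, h)\<close> with
  \<open>\<alpha> h = 1\<close>. It is abelian, because on it the twisted product is the direct one, and its cosets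
  are told apart by \<open>\<alpha> h\<close>. An edge from \<open>x\<close> to \<open>x c\<close> with \<open>c \<notin> N\<close> changes \<open>\<alpha> h\<close>, so the colour
  component \<open>\<alpha> h\<close> takes care of it. Edges with \<open>c \<in> N\<close> stay inside a left coset of \<open>N\<close>, and
  left translation identifies each such coset with the Cayley graph of \<open>N\<close> itself
  (\<open>proper_coloring_extend_subgroup\<close>). The members of the family that lie in \<open>N\<close> form a
  semiminimal family of \<open>N\<close>, so everything rests on the abelian case: four colours suffice
  (\<open>abelian_cayley_four_coloring\<close>).

  For an abelian group the idea is a circular colouring by a character. One constructs a
  homomorphism \<open>\<phi>\<close> from the group generated by the family to the circle \<open>\<real>/\<int>\<close> that maps every
  \<open>c\<^sub>i\<close> into the arc \<open>[1/4, 3/4]\<close>. Then the endpoints of an edge are at distance at least \<open>1/4\<close>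
  on the circle, so cutting the circle into four half-open quarters gives a proper colouring.

  The character is built along the well-order. When it reaches \<open>c\<^sub>i\<close>, let \<open>m\<close> be the order of
  \<open>c\<^sub>i\<close> modulo the group generated so far. If \<open>m\<close> is infinite the value at \<open>c\<^sub>i\<close> is arbitrary.
  Otherwise \<open>m \<phi>(c\<^sub>i)\<close> is prescribed modulo \<open>1\<close>, and the solutions are spaced by \<open>1/m\<close>.
  Semiminimality says precisely that \<open>m \<noteq> 1\<close>, hence the spacing is at most \<open>1/2\<close>, the length of
  the closed arc, which therefore contains a solution (\<open>ex_extension_value\<close>). Zorn's lemma turns
  this one-step extension into a total character (\<open>ex_character\<close>).

  A partial homomorphism to \<open>\<real>/\<int>\<close> is represented by its preimage graph, a subgroup \<open>\<Gamma>\<close> of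
  \<open>G \<times> \<real>\<close> in which \<open>(1, t) \<in> \<Gamma>\<close> forces \<open>t\<close> to be an integer. Such subgroups are given by
  generators, so extending the character means adding a generator, and the limit step is the
  finitary nature of generation.
\<close>

section \<open>Generated subgroups\<close>

lemma (in comm_group) generate_insertE:
  assumes "S \<subseteq> carrier G" "y \<in> carrier G" "z \<in> generate G (insert y S)"
  obtains w and n :: int where "w \<in> generate G S" "z = w \<otimes> y [^] n"
proof -
  have "\<exists>w \<in> generate G S. \<exists>n :: int. z = w \<otimes> y [^] n"
    using assms(3)
  proof induction
    case one
    show ?case using generate.one by (intro bexI[of _ \<one>] exI[of _ 0]) auto
  next
    case (incl h)
    show ?case
    proof (cases "h = y")
      case True
      thus ?thesis using assms by (intro bexI[of _ \<one>] exI[of _ 1]) (auto intro: generate.one)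
    next
      case False
      with incl have "h \<in> S" by simp
      thus ?thesis using assms by (intro bexI[of _ h] exI[of _ 0]) (auto intro: generate.incl)
    qed
  next
    case (inv h)
    show ?case
    proof (cases "h = y")
      case True
      thus ?thesis using assms
        by (intro bexI[of _ \<one>] exI[of _ "-1"]) (auto intro: generate.one simp: int_pow_neg)
    next
      case False
      with inv have "h \<in> S" by simp
      thus ?thesis using assms by (intro bexI[of _ "inv h"] exI[of _ 0]) (auto intro: generate.inv)
    qed
  next
    case (eng h1 h2)
    then obtain w1 w2 and n1 n2 :: int where
      w: "w1 \<in> generate G S" "h1 = w1 \<otimes> y [^] n1" "w2 \<in> generate G S" "h2 = w2 \<otimes> y [^] n2"
      by blast
    note c = generate_in_carrier[OF assms(1)]
    have "h1 \<otimes> h2 = (w1 \<otimes> w2) \<otimes> y [^] (n1 + n2)"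
      using w c assms(2) by (simp add: int_pow_mult m_ac)
    thus ?case using w(1,3) by (blast intro: generate.eng)
  qed
  thus thesis using that by blast
qed

text \<open>
  An element of a generated subgroup involves only finitely many generators.
\<close>

lemma (in group) generate_chain_Union:
  assumes "\<C> \<noteq> {}" "\<And>X Y. X \<in> \<C> \<Longrightarrow> Y \<in> \<C> \<Longrightarrow> X \<subseteq> Y \<or> Y \<subseteq> X"
    and "z \<in> generate G (\<Union>\<C>)"
  shows "\<exists>X \<in> \<C>. z \<in> generate G X"
  using assms(3)
proof induction
  case (eng h1 h2)
  then obtain X Y where XY: "X \<in> \<C>" "h1 \<in> generate G X" "Y \<in> \<C>" "h2 \<in> generate G Y" by blast
  show ?case
  proof (cases "X \<subseteq> Y")
    case True
    with XY mono_generate[of X Y] show ?thesis by (blast intro: generate.eng)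
  next
    case False
    with assms(2)[OF XY(1,3)] XY mono_generate[of Y X] show ?thesis by (blast intro: generate.eng)
  qed
qed (use assms(1) in \<open>blast intro: generate.intros\<close>)+

section \<open>Characters with prescribed arcs\<close>

definition additive_reals :: "real monoid"
  where "additive_reals = \<lparr>carrier = UNIV, mult = (+), one = 0\<rparr>"

lemma additive_reals_simps [simp]:
  "carrier additive_reals = UNIV" "x \<otimes>\<^bsub>additive_reals\<^esub> y = x + y" "\<one>\<^bsub>additive_reals\<^esub> = 0"
  by (simp_all add: additive_reals_def)

lemma comm_group_additive_reals: "comm_group additive_reals"
  by (rule comm_groupI) (auto intro: exI[of _ "- x" for x])

lemma inv_additive_reals [simp]: "inv\<^bsub>additive_reals\<^esub> x = - x"
  using comm_group_additive_reals
  by (intro group.inv_equality) (auto simp: comm_group_def)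

lemma int_pow_additive_reals [simp]: "x [^]\<^bsub>additive_reals\<^esub> (n :: int) = of_int n * x"
proof -
  have "x [^]\<^bsub>additive_reals\<^esub> (k :: nat) = of_nat k * x" for k
    by (induction k) (auto simp: algebra_simps)
  thus ?thesis by (simp add: int_pow_def2)
qed

abbreviation product_with_reals :: "('g, 'm) monoid_scheme \<Rightarrow> ('g \<times> real) monoid"
  where "product_with_reals G \<equiv> G \<times>\<times> additive_reals"

lemma comm_group_product_with_reals:
  assumes "comm_group G"
  shows "comm_group (product_with_reals G)"
proof -
  interpret G: comm_group G by fact
  interpret R: comm_group additive_reals by (rule comm_group_additive_reals)
  interpret P: group "product_with_reals G"
    by (intro DirProd_group G.group_axioms R.group_axioms)
  show ?thesis by (rule P.group_comm_groupI) (auto simp: G.m_comm)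
qed

lemma int_pow_product_with_reals:
  assumes "comm_group G" "a \<in> carrier G"
  shows "(a, t) [^]\<^bsub>product_with_reals G\<^esub> (n :: int) = (a [^]\<^bsub>G\<^esub> n, of_int n * t)"
proof -
  interpret G: comm_group G by fact
  interpret P: comm_group "product_with_reals G" by (rule comm_group_product_with_reals) fact
  have R: "group additive_reals" using comm_group_additive_reals by (simp add: comm_group_def)
  have 1: "fst \<in> hom (product_with_reals G) G" and 2: "snd \<in> hom (product_with_reals G) additive_reals"
    by (auto simp: hom_def)
  show ?thesis
    using hom_int_pow[OF 1, of "(a, t)" n] hom_int_pow[OF 2, of "(a, t)" n] assms R
    by (simp add: prod_eq_iff G.group_axioms P.group_axioms)
qed

text \<open>
  For a subgroup \<open>\<Gamma>\<close> of \<open>G \<times> \<real>\<close> this says that \<open>\<Gamma>\<close>, read as a relation, is a homomorphism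
  from its first projection to \<open>\<real>/\<int>\<close>: two values of the same element differ by a value of \<open>1\<close>.
\<close>

definition single_valued_mod1 :: "('g, 'm) monoid_scheme \<Rightarrow> ('g \<times> real) set \<Rightarrow> bool"
  where "single_valued_mod1 G \<Gamma> \<longleftrightarrow> (\<forall>t. (\<one>\<^bsub>G\<^esub>, t) \<in> \<Gamma> \<longrightarrow> t \<in> \<int>)"

text \<open>
  The conclusion says that adjoining \<open>(y, x)\<close> to \<open>\<Gamma>\<close> keeps it single-valued. The exponents \<open>n\<close>
  with \<open>y^n\<close> in the domain of \<open>\<Gamma>\<close> are the multiples of some \<open>m\<close>. If \<open>m = 0\<close>, there is no
  constraint on \<open>x\<close>. If \<open>m > 0\<close> and \<open>u\<close> is a value of \<open>y^m\<close>, the only constraint is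
  \<open>m x \<equiv> u (mod 1)\<close>. As \<open>y\<close> itself is outside the domain, \<open>m \<ge> 2\<close>, so the solutions are at most
  \<open>1/2\<close> apart.
\<close>

lemma ex_extension_value:
  assumes "comm_group G" and \<Gamma>: "subgroup \<Gamma> (product_with_reals G)" and sv: "single_valued_mod1 G \<Gamma>"
    and y: "y \<in> carrier G" "y \<notin> fst ` \<Gamma>"
  shows "\<exists>x \<in> {1/4..3/4}. \<forall>a s n. (a, s) \<in> \<Gamma> \<longrightarrow> a \<otimes>\<^bsub>G\<^esub> y [^]\<^bsub>G\<^esub> (n :: int) = \<one>\<^bsub>G\<^esub> \<longrightarrow>
           s + of_int n * x \<in> \<int>"
proof -
  interpret G: comm_group G by fact
  interpret P: comm_group "product_with_reals G" by (rule comm_group_product_with_reals) fact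
  interpret \<Gamma>: subgroup \<Gamma> "product_with_reals G" by fact
  have pow: "(a [^]\<^bsub>G\<^esub> k, of_int k * s) \<in> \<Gamma>" if "(a, s) \<in> \<Gamma>" for a s and k :: int
    using P.subgroup_int_pow_closed[OF \<Gamma> that, of k] \<Gamma>.mem_carrier[OF that]
    by (simp add: int_pow_product_with_reals assms(1))
  have mul: "(a \<otimes>\<^bsub>G\<^esub> b, s + t) \<in> \<Gamma>" if "(a, s) \<in> \<Gamma>" "(b, t) \<in> \<Gamma>" for a b s t
    using \<Gamma>.m_closed[OF that] by simp
  have neg: "(y [^]\<^bsub>G\<^esub> n, - s) \<in> \<Gamma>" if "(a, s) \<in> \<Gamma>" "a \<otimes>\<^bsub>G\<^esub> y [^]\<^bsub>G\<^esub> n = \<one>\<^bsub>G\<^esub>" for a s and n :: int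
  proof -
    have a: "a \<in> carrier G" using \<Gamma>.mem_carrier[OF that(1)] by simp
    have "y [^]\<^bsub>G\<^esub> n = inv\<^bsub>G\<^esub> a"
      using G.inv_equality[of "y [^]\<^bsub>G\<^esub> n" a] that(2) a y by (simp add: G.m_comm)
    thus ?thesis using pow[OF that(1), of "-1"] a by (simp add: G.int_pow_neg)
  qed
  define M where "M = {n :: nat. n > 0 \<and> (\<exists>u. (y [^]\<^bsub>G\<^esub> int n, u) \<in> \<Gamma>)}"
  show ?thesis
  proof (cases "M = {}")
    case True
    have "s + of_int n * (1/2) \<in> \<int>" if h: "(a, s) \<in> \<Gamma>" "a \<otimes>\<^bsub>G\<^esub> y [^]\<^bsub>G\<^esub> n = \<one>\<^bsub>G\<^esub>" for a s n
    proof -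
      have n: "(y [^]\<^bsub>G\<^esub> n, - s) \<in> \<Gamma>" using neg[OF h] .
      have "n = 0"
      proof (rule ccontr)
        assume "n \<noteq> 0"
        have "(y [^]\<^bsub>G\<^esub> \<bar>n\<bar>, of_int (sgn n) * - s) \<in> \<Gamma>"
          using pow[OF n, of "sgn n"] y by (simp add: G.int_pow_pow abs_sgn)
        hence "nat \<bar>n\<bar> \<in> M" using \<open>n \<noteq> 0\<close> by (auto simp: M_def)
        with True show False by simp
      qed
      with n sv have "- s \<in> \<int>" by (auto simp: single_valued_mod1_def)
      with \<open>n = 0\<close> show ?thesis by (simp add: minus_in_Ints_iff)
    qed
    thus ?thesis by (intro bexI[of _ "1/2"]) auto
  next
    case False
    define m where "m = (LEAST n. n \<in> M)"
    have "m \<in> M" unfolding m_def using False by (metis LeastI ex_in_conv)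
    then obtain u where m: "m > 0" and u: "(y [^]\<^bsub>G\<^esub> int m, u) \<in> \<Gamma>" by (auto simp: M_def)
    have "m \<noteq> 1" using u y(2) by (auto simp: G.int_pow_1 y(1) image_iff)
    with m have m2: "m \<ge> 2" by simp
    \<comment> \<open>the least shift for which the solution is at least \<open>1/4\<close>; it is then below
      \<open>1/4 + 1/m \<le> 3/4\<close>\<close>
    define j where "j = \<lceil>real m / 4 - u\<rceil>"
    define x where "x = (u + of_int j) / real m"
    have j: "real m / 4 \<le> u + of_int j" "u + of_int j < real m / 4 + 1"
      unfolding j_def by linarith+
    have "x \<in> {1/4..3/4}"
      using j m2 by (auto simp: x_def field_simps)
    moreover have "s + of_int n * x \<in> \<int>"
      if h: "(a, s) \<in> \<Gamma>" "a \<otimes>\<^bsub>G\<^esub> y [^]\<^bsub>G\<^esub> n = \<one>\<^bsub>G\<^esub>" for a s n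
    proof -
      define q \<rho> where "q = n div int m" and "\<rho> = n mod int m"
      have n: "n = int m * q + \<rho>" by (simp add: q_def \<rho>_def)
      have \<rho>: "0 \<le> \<rho>" "\<rho> < int m" using m by (simp_all add: \<rho>_def)
      have "(y [^]\<^bsub>G\<^esub> n \<otimes>\<^bsub>G\<^esub> y [^]\<^bsub>G\<^esub> (int m * - q), - s + of_int (- q) * u) \<in> \<Gamma>"
        using mul[OF neg[OF h] pow[OF u, of "- q"]] y by (simp only: G.int_pow_pow)
      also have "y [^]\<^bsub>G\<^esub> n \<otimes>\<^bsub>G\<^esub> y [^]\<^bsub>G\<^esub> (int m * - q) = y [^]\<^bsub>G\<^esub> \<rho>"
        using y(1) by (simp add: n flip: G.int_pow_mult)
      finally have *: "(y [^]\<^bsub>G\<^esub> \<rho>, - s + of_int (- q) * u) \<in> \<Gamma>" .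
      have "\<rho> = 0"
      proof (rule ccontr)
        assume "\<rho> \<noteq> 0"
        hence "nat \<rho> \<in> M" using * \<rho> by (auto simp: M_def)
        hence "m \<le> nat \<rho>" unfolding m_def by (rule Least_le)
        thus False using \<rho> by simp
      qed
      hence "- s + of_int (- q) * u \<in> \<int>" using * sv by (auto simp: single_valued_mod1_def)
      hence "of_int (q * j) - (- s + of_int (- q) * u) \<in> \<int>" by (intro Ints_diff Ints_of_int)
      also have "of_int (q * j) - (- s + of_int (- q) * u) = s + of_int n * x"
        using m by (simp add: n \<open>\<rho> = 0\<close> x_def field_simps)
      finally show ?thesis .
    qed
    ultimately show ?thesis by blast
  qed
qed

text \<open>
  Zorn's lemma is applied to sets \<open>E\<close> of assignments of real values to indices, ordered by
  inclusion. Their index sets are kept down-closed, so that the least index outside a maximal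
  \<open>E\<close> has exactly the indices of \<open>E\<close> below it; semiminimality is then the hypothesis of
  \<open>ex_extension_value\<close> on the new element. The function \<open>\<phi>\<close> picks representatives in \<open>\<real>\<close> of the
  values in \<open>\<real>/\<int>\<close>, so its increment along an edge is known only up to an integer.
\<close>

lemma ex_character:
  fixes c :: "'i \<Rightarrow> 'g"
  assumes "comm_group G" and semimin: "semiminimal_family G r c"
  obtains \<phi> :: "'g \<Rightarrow> real" where
    "\<And>x i. x \<in> generate G (c ` Field r) \<Longrightarrow> i \<in> Field r \<Longrightarrow>
       \<exists>v \<in> {1/4..3/4}. \<phi> (x \<otimes>\<^bsub>G\<^esub> c i) - \<phi> x - v \<in> \<int>"
proof -
  interpret G: comm_group G by fact
  let ?P = "product_with_reals G"
  interpret P: comm_group ?P by (rule comm_group_product_with_reals) fact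
  have r: "Well_order r" and c: "c ` Field r \<subseteq> carrier G"
    and indep: "\<And>i. i \<in> Field r \<Longrightarrow> c i \<notin> generate G (c ` underS r i)"
    using semimin by (auto simp: semiminimal_family_def)
  interpret wo: wo_rel r using r by (simp add: wo_rel_def)
  define gen where "gen E = generate ?P (map_prod c id ` E)" for E :: "('i \<times> real) set"
  \<comment> \<open>\<open>E\<close> may assign several values to one index: single-valuedness of the generated subgroup
    makes them agree modulo \<open>1\<close>\<close>
  define \<E> where "\<E> = {E. E \<subseteq> Field r \<times> {1/4..3/4} \<and>
    (\<forall>i \<in> fst ` E. underS r i \<subseteq> fst ` E) \<and> single_valued_mod1 G (gen E)}"
  have carr: "map_prod c id ` E \<subseteq> carrier ?P" if "E \<in> \<E>" for E
    using that c by (auto simp: \<E>_def)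
  have fst_gen: "fst ` gen E = generate G (c ` fst ` E)" if "E \<in> \<E>" for E
  proof -
    interpret group_hom ?P G fst by unfold_locales (auto simp: hom_def)
    show ?thesis using generate_img[OF carr[OF that]]
      by (simp add: gen_def image_image)
  qed
  have sub: "subgroup (gen E) ?P" if "E \<in> \<E>" for E
    unfolding gen_def by (rule P.generate_is_subgroup[OF carr[OF that]])
  have "\<Union>\<C> \<in> \<E>" if \<C>: "\<C> \<in> chains \<E>" for \<C>
  proof (cases "\<C> = {}")
    case True
    have "gen {} = {\<one>\<^bsub>?P\<^esub>}" by (simp add: gen_def P.generate_empty)
    thus ?thesis using True by (simp add: \<E>_def single_valued_mod1_def)
  next
    case False
    have \<C>': "\<C> \<subseteq> \<E>" "\<And>X Y. X \<in> \<C> \<Longrightarrow> Y \<in> \<C> \<Longrightarrow> X \<subseteq> Y \<or> Y \<subseteq> X"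
      using \<C> by (auto simp: chains_def chain_subset_def)
    have "t \<in> \<int>" if "(\<one>\<^bsub>G\<^esub>, t) \<in> gen (\<Union>\<C>)" for t
    proof -
      have "\<exists>X \<in> (`) (map_prod c id) ` \<C>. (\<one>\<^bsub>G\<^esub>, t) \<in> generate ?P X"
      proof (rule P.generate_chain_Union)
        show "(\<one>\<^bsub>G\<^esub>, t) \<in> generate ?P (\<Union> ((`) (map_prod c id) ` \<C>))"
          using that by (simp add: gen_def image_Union)
        show "(`) (map_prod c id) ` \<C> \<noteq> {}" using False by simp
        show "X \<subseteq> Y \<or> Y \<subseteq> X"
          if XY: "X \<in> (`) (map_prod c id) ` \<C>" "Y \<in> (`) (map_prod c id) ` \<C>" for X Y
        proof -
          obtain X' Y' where X': "X' \<in> \<C>" "X = map_prod c id ` X'"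
            and Y': "Y' \<in> \<C>" "Y = map_prod c id ` Y'"
            using XY by blast
          show ?thesis using \<C>'(2)[OF X'(1) Y'(1)] unfolding X'(2) Y'(2)
            by (elim disjE) (simp_all add: image_mono)
        qed
      qed
      thus ?thesis using \<C>'(1) by (auto simp: \<E>_def single_valued_mod1_def gen_def)
    qed
    moreover have "\<Union>\<C> \<subseteq> Field r \<times> {1/4..3/4}" using \<C>'(1) by (auto simp: \<E>_def)
    moreover have "\<forall>i \<in> fst ` \<Union>\<C>. underS r i \<subseteq> fst ` \<Union>\<C>"
    proof
      fix i assume "i \<in> fst ` \<Union>\<C>"
      then obtain E where "E \<in> \<C>" "i \<in> fst ` E" by auto
      with \<C>'(1) have "underS r i \<subseteq> fst ` E" by (auto simp: \<E>_def)
      with \<open>E \<in> \<C>\<close> show "underS r i \<subseteq> fst ` \<Union>\<C>" by blast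
    qed
    ultimately show ?thesis by (simp add: \<E>_def single_valued_mod1_def)
  qed
  then obtain E where E: "E \<in> \<E>" and max: "\<And>E'. E' \<in> \<E> \<Longrightarrow> E \<subseteq> E' \<Longrightarrow> E' = E"
    using Zorn_Lemma[of \<E>] by blast
  have E': "fst ` E \<subseteq> Field r" "\<And>i. i \<in> fst ` E \<Longrightarrow> underS r i \<subseteq> fst ` E" "single_valued_mod1 G (gen E)"
    using E by (auto simp: \<E>_def)
  have total: "fst ` E = Field r"
  proof (rule ccontr)
    assume "fst ` E \<noteq> Field r"
    define i where "i = wo.minim (Field r - fst ` E)"
    have ne: "Field r - fst ` E \<noteq> {}" using \<open>fst ` E \<noteq> Field r\<close> E'(1) by blast
    have i: "i \<in> Field r" "i \<notin> fst ` E" using wo.minim_in[OF _ ne] by (auto simp: i_def)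
    have least: "j \<in> fst ` E" if "j \<in> underS r i" for j
    proof (rule ccontr)
      assume "j \<notin> fst ` E"
      hence "(i, j) \<in> r"
        using wo.minim_least[of "Field r - fst ` E" j] that by (auto simp: i_def underS_def Field_def)
      with that show False using wo.ANTISYM by (auto simp: underS_def antisym_def)
    qed
    have "fst ` E = underS r i"
    proof
      show "underS r i \<subseteq> fst ` E" using least by blast
      show "fst ` E \<subseteq> underS r i"
      proof
        fix j assume j: "j \<in> fst ` E"
        have "j \<noteq> i" using i j by blast
        moreover have "(i, j) \<notin> r" using E'(2)[OF j] i \<open>j \<noteq> i\<close> by (auto simp: underS_def)
        ultimately show "j \<in> underS r i"
          using wo.TOTALS i(1) j E'(1) by (auto simp: underS_def)
      qed
    qed
    hence "c i \<notin> fst ` gen E" using indep[OF i(1)] fst_gen[OF E] by simp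
    then obtain x where x: "x \<in> {1/4..3/4}" and ext: "\<And>a s n. (a, s) \<in> gen E \<Longrightarrow>
        a \<otimes>\<^bsub>G\<^esub> c i [^]\<^bsub>G\<^esub> (n :: int) = \<one>\<^bsub>G\<^esub> \<Longrightarrow> s + of_int n * x \<in> \<int>"
      using ex_extension_value[OF assms(1) sub[OF E] E'(3), of "c i"] c i(1) by blast
    have ci: "c i \<in> carrier G" using c i(1) by auto
    have "t \<in> \<int>" if "(\<one>\<^bsub>G\<^esub>, t) \<in> gen (insert (i, x) E)" for t
    proof -
      have *: "(\<one>\<^bsub>G\<^esub>, t) \<in> generate ?P (insert (c i, x) (map_prod c id ` E))"
        using that by (simp add: gen_def)
      obtain w and n :: int
        where w: "w \<in> gen E" "(\<one>\<^bsub>G\<^esub>, t) = w \<otimes>\<^bsub>?P\<^esub> (c i, x) [^]\<^bsub>?P\<^esub> n"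
        unfolding gen_def using ci by (auto intro: P.generate_insertE[OF carr[OF E] _ *])
      thus ?thesis using ext[of "fst w" "snd w" n] ci
        by (cases w) (simp add: int_pow_product_with_reals[OF assms(1)])
    qed
    hence "insert (i, x) E \<in> \<E>"
      using E i(1) x least by (auto simp: \<E>_def single_valued_mod1_def)
    hence "(i, x) \<in> E" using max[of "insert (i, x) E"] by blast
    thus False using i(2) by force
  qed
  define \<phi> where "\<phi> x = (SOME t. (x, t) \<in> gen E)" for x
  have \<phi>: "(x, \<phi> x) \<in> gen E" if "x \<in> generate G (c ` Field r)" for x
  proof -
    have "x \<in> fst ` gen E" using that fst_gen[OF E] total by simp
    thus ?thesis unfolding \<phi>_def by (auto intro: someI)
  qed
  show thesis
  proof (rule that)
    fix x i assume x: "x \<in> generate G (c ` Field r)" and i: "i \<in> Field r"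
    interpret \<Gamma>: subgroup "gen E" ?P by (rule sub[OF E])
    obtain v where v: "(i, v) \<in> E" using i total by (metis imageE prod.collapse)
    have vin: "v \<in> {1/4..3/4}" using v E by (auto simp: \<E>_def)
    have cv: "(c i, v) \<in> gen E" unfolding gen_def using v by (force intro: generate.incl)
    have ci: "c i \<in> carrier G" and xc: "x \<in> carrier G"
      using c i x G.generate_in_carrier[OF c] by auto
    have "x \<otimes>\<^bsub>G\<^esub> c i \<in> generate G (c ` Field r)" using x i by (blast intro: generate.intros)
    note 1 = \<phi>[OF this]
    have 2: "inv\<^bsub>?P\<^esub> (x, \<phi> x) = (inv\<^bsub>G\<^esub> x, - \<phi> x)"
      and 3: "inv\<^bsub>?P\<^esub> (c i, v) = (inv\<^bsub>G\<^esub> c i, - v)"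
      using comm_group_additive_reals xc ci by (simp_all add: comm_group_def)
    have "(x \<otimes>\<^bsub>G\<^esub> c i, \<phi> (x \<otimes>\<^bsub>G\<^esub> c i)) \<otimes>\<^bsub>?P\<^esub> inv\<^bsub>?P\<^esub> (x, \<phi> x) \<otimes>\<^bsub>?P\<^esub> inv\<^bsub>?P\<^esub> (c i, v) \<in> gen E"
      by (intro \<Gamma>.m_closed \<Gamma>.m_inv_closed 1 \<phi>[OF x] cv)
    hence "(x \<otimes>\<^bsub>G\<^esub> c i \<otimes>\<^bsub>G\<^esub> inv\<^bsub>G\<^esub> x \<otimes>\<^bsub>G\<^esub> inv\<^bsub>G\<^esub> c i, \<phi> (x \<otimes>\<^bsub>G\<^esub> c i) - \<phi> x - v) \<in> gen E"
      by (simp add: 2 3)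
    also have "x \<otimes>\<^bsub>G\<^esub> c i \<otimes>\<^bsub>G\<^esub> inv\<^bsub>G\<^esub> x \<otimes>\<^bsub>G\<^esub> inv\<^bsub>G\<^esub> c i = \<one>\<^bsub>G\<^esub>"
      using xc ci by (simp add: G.m_comm[OF xc ci] G.m_assoc)
    finally have "\<phi> (x \<otimes>\<^bsub>G\<^esub> c i) - \<phi> x - v \<in> \<int>" using E'(3) by (simp add: single_valued_mod1_def)
    with vin show "\<exists>v \<in> {1/4..3/4}. \<phi> (x \<otimes>\<^bsub>G\<^esub> c i) - \<phi> x - v \<in> \<int>" by blast
  qed
qed

section \<open>Colouring abelian Cayley graphs\<close>

text \<open>
  Edges with labels in \<open>K\<close> never leave a left coset of \<open>K\<close>, and left translations are
  automorphisms of the Cayley graph. So each coset can be coloured by translating it onto \<open>K\<close>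
  with a chosen representative.
\<close>

lemma proper_coloring_extend_subgroup:
  assumes "group G" "subgroup K G" "S \<subseteq> K"
    and col: "proper_coloring (cayley_graph (G\<lparr>carrier := K\<rparr>) S) g"
  obtains g' where "proper_coloring (cayley_graph G S) g'" "g' ` carrier G \<subseteq> g ` K"
proof -
  interpret group G by fact
  interpret K: subgroup K G by fact
  define rep where "rep X = (SOME t. t \<in> X)" for X :: "'a set"
  have rep: "rep (x <#\<^bsub>G\<^esub> K) \<in> carrier G" "inv\<^bsub>G\<^esub> rep (x <#\<^bsub>G\<^esub> K) \<otimes>\<^bsub>G\<^esub> x \<in> K"
    if x: "x \<in> carrier G" for x
  proof -
    have "x \<otimes>\<^bsub>G\<^esub> \<one>\<^bsub>G\<^esub> \<in> x <#\<^bsub>G\<^esub> K"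
      unfolding l_coset_def using K.one_closed by blast
    hence "rep (x <#\<^bsub>G\<^esub> K) \<in> x <#\<^bsub>G\<^esub> K" unfolding rep_def by (rule someI)
    then obtain k where k: "k \<in> K" "rep (x <#\<^bsub>G\<^esub> K) = x \<otimes>\<^bsub>G\<^esub> k" by (auto simp: l_coset_def)
    thus "rep (x <#\<^bsub>G\<^esub> K) \<in> carrier G" "inv\<^bsub>G\<^esub> rep (x <#\<^bsub>G\<^esub> K) \<otimes>\<^bsub>G\<^esub> x \<in> K"
      using x by (simp_all add: inv_mult_group m_assoc)
  qed
  define g' where "g' x = g (inv\<^bsub>G\<^esub> rep (x <#\<^bsub>G\<^esub> K) \<otimes>\<^bsub>G\<^esub> x)" for x
  have "g' x \<noteq> g' y" if xy: "(x, y) \<in> snd (cayley_graph G S)" for x y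
  proof -
    have c: "x \<in> carrier G" "y \<in> carrier G" "x \<noteq> y"
      and e: "inv\<^bsub>G\<^esub> x \<otimes>\<^bsub>G\<^esub> y \<in> S \<union> m_inv G ` S"
      using xy by (auto simp: cayley_graph_def)
    have "inv\<^bsub>G\<^esub> x \<otimes>\<^bsub>G\<^esub> y \<in> K" using e assms(3) by auto
    moreover have "y = x \<otimes>\<^bsub>G\<^esub> (inv\<^bsub>G\<^esub> x \<otimes>\<^bsub>G\<^esub> y)" using c by (simp flip: m_assoc)
    ultimately have "y \<in> x <#\<^bsub>G\<^esub> K" unfolding l_coset_def by blast
    hence eq: "y <#\<^bsub>G\<^esub> K = x <#\<^bsub>G\<^esub> K"
      using l_repr_independence[OF _ c(1) assms(2)] by blast
    define t where "t = rep (x <#\<^bsub>G\<^esub> K)"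
    have t: "t \<in> carrier G" "inv\<^bsub>G\<^esub> t \<otimes>\<^bsub>G\<^esub> x \<in> K" "inv\<^bsub>G\<^esub> t \<otimes>\<^bsub>G\<^esub> y \<in> K"
      using rep[OF c(1)] rep[OF c(2)] by (simp_all add: t_def eq)
    have "inv\<^bsub>G\<^esub> (inv\<^bsub>G\<^esub> t \<otimes>\<^bsub>G\<^esub> x) \<otimes>\<^bsub>G\<^esub> (inv\<^bsub>G\<^esub> t \<otimes>\<^bsub>G\<^esub> y) = inv\<^bsub>G\<^esub> x \<otimes>\<^bsub>G\<^esub> y"
    proof -
      have "t \<otimes>\<^bsub>G\<^esub> (inv\<^bsub>G\<^esub> t \<otimes>\<^bsub>G\<^esub> y) = y" using c t(1) by (simp flip: m_assoc)
      thus ?thesis using c t(1) by (simp add: inv_mult_group m_assoc)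
    qed
    moreover have "m_inv G ` S = m_inv (G\<lparr>carrier := K\<rparr>) ` S"
      using assms(3) m_inv_consistent[OF assms(2)] by (intro image_cong) auto
    moreover have "inv\<^bsub>G\<^esub> t \<otimes>\<^bsub>G\<^esub> x \<noteq> inv\<^bsub>G\<^esub> t \<otimes>\<^bsub>G\<^esub> y" using c t(1) by simp
    ultimately have "(inv\<^bsub>G\<^esub> t \<otimes>\<^bsub>G\<^esub> x, inv\<^bsub>G\<^esub> t \<otimes>\<^bsub>G\<^esub> y) \<in> snd (cayley_graph (G\<lparr>carrier := K\<rparr>) S)"
      using e t(2,3) m_inv_consistent[OF assms(2)] by (simp add: cayley_graph_def)
    thus ?thesis using col by (auto simp: proper_coloring_def g'_def eq t_def)
  qed
  hence "proper_coloring (cayley_graph G S) g'" by (auto simp: proper_coloring_def)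
  moreover have "g' ` carrier G \<subseteq> g ` K" using rep(2) by (auto simp: g'_def)
  ultimately show thesis by (rule that)
qed

text \<open>
  The colour of \<open>x\<close> is the index of the quarter of the circle that contains \<open>\<phi> x\<close>. Two points of
  the same quarter are less than \<open>1/4\<close> apart, while neighbours differ by an element of the arc
  \<open>[1/4, 3/4]\<close>. The character lives on the generated subgroup only; the colouring spreads to the
  other cosets by translation.
\<close>

lemma abelian_cayley_four_coloring:
  fixes c :: "'i \<Rightarrow> 'g"
  assumes "comm_group G" and "semiminimal_family G r c"
  obtains g :: "'g \<Rightarrow> nat" where "proper_coloring (cayley_graph G (c ` Field r)) g" "g ` carrier G \<subseteq> {..<4}"
proof -
  interpret G: comm_group G by fact
  let ?C = "c ` Field r"
  let ?K = "generate G ?C"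
  have C: "?C \<subseteq> carrier G" using assms(2) by (simp add: semiminimal_family_def)
  have K: "subgroup ?K G" by (rule G.generate_is_subgroup[OF C])
  obtain \<phi> :: "'g \<Rightarrow> real" where \<phi>: "\<And>x i. x \<in> ?K \<Longrightarrow> i \<in> Field r \<Longrightarrow>
      \<exists>v \<in> {1/4..3/4}. \<phi> (x \<otimes>\<^bsub>G\<^esub> c i) - \<phi> x - v \<in> \<int>"
    using ex_character[OF assms] by blast
  define g where "g x = nat \<lfloor>4 * frac (\<phi> x)\<rfloor>" for x
  have step: "g (x \<otimes>\<^bsub>G\<^esub> c i) \<noteq> g x" if xi: "x \<in> ?K" "i \<in> Field r" for x i
  proof
    assume "g (x \<otimes>\<^bsub>G\<^esub> c i) = g x"
    moreover have "\<lfloor>4 * frac (\<phi> z)\<rfloor> \<ge> 0" for z by (simp add: frac_ge_0)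
    ultimately have "\<lfloor>4 * frac (\<phi> (x \<otimes>\<^bsub>G\<^esub> c i))\<rfloor> = \<lfloor>4 * frac (\<phi> x)\<rfloor>"
      by (metis g_def int_nat_eq)
    hence d: "\<bar>frac (\<phi> (x \<otimes>\<^bsub>G\<^esub> c i)) - frac (\<phi> x)\<bar> < 1/4" by linarith
    obtain v k where v: "v \<in> {1/4..3/4}" and k: "\<phi> (x \<otimes>\<^bsub>G\<^esub> c i) - \<phi> x - v = of_int k"
      using \<phi>[OF xi] by (auto elim: Ints_cases)
    have "frac (\<phi> (x \<otimes>\<^bsub>G\<^esub> c i)) - frac (\<phi> x)
        = v + of_int (k - \<lfloor>\<phi> (x \<otimes>\<^bsub>G\<^esub> c i)\<rfloor> + \<lfloor>\<phi> x\<rfloor>)"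
      using k by (simp add: frac_def)
    then obtain l :: int where "\<bar>v + of_int l\<bar> < 1/4" using d by metis
    hence "-1 < real_of_int l" "real_of_int l < 0"
      using v unfolding abs_less_iff atLeastAtMost_iff by linarith+
    hence "real_of_int (-1) < real_of_int l" "l < 0" by simp_all
    thus False unfolding of_int_less_iff by simp
  qed
  have "g x \<noteq> g y" if xy: "(x, y) \<in> snd (cayley_graph (G\<lparr>carrier := ?K\<rparr>) ?C)" for x y
  proof -
    interpret K: subgroup ?K G by (rule K)
    have sub: "?C \<subseteq> ?K" by (auto intro: generate.incl)
    have c: "x \<in> ?K" "y \<in> ?K" using xy by (auto simp: cayley_graph_def)
    have "m_inv G ` ?C = m_inv (G\<lparr>carrier := ?K\<rparr>) ` ?C"
      using sub G.m_inv_consistent[OF K] by (intro image_cong) auto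
    hence "inv\<^bsub>G\<^esub> x \<otimes>\<^bsub>G\<^esub> y \<in> ?C \<union> m_inv G ` ?C"
      using xy G.m_inv_consistent[OF K] by (auto simp: cayley_graph_def)
    then obtain i where i: "i \<in> Field r"
      "inv\<^bsub>G\<^esub> x \<otimes>\<^bsub>G\<^esub> y = c i \<or> inv\<^bsub>G\<^esub> x \<otimes>\<^bsub>G\<^esub> y = inv\<^bsub>G\<^esub> c i" by blast
    have ci: "c i \<in> carrier G" using i C by auto
    note cc = K.mem_carrier[OF c(1)] K.mem_carrier[OF c(2)]
    from i(2) have "y = x \<otimes>\<^bsub>G\<^esub> c i \<or> x = y \<otimes>\<^bsub>G\<^esub> c i"
    proof
      assume "inv\<^bsub>G\<^esub> x \<otimes>\<^bsub>G\<^esub> y = c i"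
      thus ?thesis using cc ci by (metis G.inv_solve_left)
    next
      assume "inv\<^bsub>G\<^esub> x \<otimes>\<^bsub>G\<^esub> y = inv\<^bsub>G\<^esub> c i"
      hence "c i = inv\<^bsub>G\<^esub> (inv\<^bsub>G\<^esub> x \<otimes>\<^bsub>G\<^esub> y)" using ci by simp
      hence "c i = inv\<^bsub>G\<^esub> y \<otimes>\<^bsub>G\<^esub> x" using cc by (simp add: G.inv_mult_group)
      thus ?thesis using cc ci by (metis G.inv_solve_left)
    qed
    thus ?thesis using step i(1) c by metis
  qed
  hence "proper_coloring (cayley_graph (G\<lparr>carrier := ?K\<rparr>) ?C) g" by (auto simp: proper_coloring_def)
  then obtain g' where g': "proper_coloring (cayley_graph G ?C) g'" "g' ` carrier G \<subseteq> g ` ?K"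
    using proper_coloring_extend_subgroup[OF G.group_axioms K] by (metis generate.incl subsetI)
  have "g x < 4" for x
    using frac_lt_1[of "\<phi> x"] frac_ge_0[of "\<phi> x"] unfolding g_def by linarith
  with g' show thesis by (intro that[of g']) auto
qed

section \<open>Reduction to the kernel of the action\<close>

text \<open>
  Discarding members of a semiminimal family keeps it semiminimal, since fewer predecessors
  generate less.
\<close>

lemma semiminimal_family_subgroup:
  assumes "group G" "semiminimal_family G r c" "subgroup N G"
    and J: "J = {i \<in> Field r. c i \<in> N}"
  shows "semiminimal_family (G\<lparr>carrier := N\<rparr>) (Restr r J) c" "Field (Restr r J) = J"
proof -
  interpret group G by fact
  have r: "Well_order r" and c: "c ` Field r \<subseteq> carrier G"
    and indep: "\<And>i. i \<in> Field r \<Longrightarrow> c i \<notin> generate G (c ` underS r i)"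
    using assms(2) by (auto simp: semiminimal_family_def)
  show F: "Field (Restr r J) = J"
    using r J by (intro Refl_Field_Restr2) (auto simp: order_on_defs)
  have "c i \<notin> generate (G\<lparr>carrier := N\<rparr>) (c ` underS (Restr r J) i)" if "i \<in> J" for i
  proof
    assume "c i \<in> generate (G\<lparr>carrier := N\<rparr>) (c ` underS (Restr r J) i)"
    moreover have "c ` underS (Restr r J) i \<subseteq> N" using J by (auto simp: underS_def)
    ultimately have "c i \<in> generate G (c ` underS (Restr r J) i)"
      using generate_consistent[OF _ assms(3)] by metis
    moreover have "c ` underS (Restr r J) i \<subseteq> c ` underS r i" by (auto simp: underS_def)
    ultimately show False using mono_generate indep that J by blast
  qed
  thus "semiminimal_family (G\<lparr>carrier := N\<rparr>) (Restr r J) c"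
    using Well_order_Restr[OF r, of J] J unfolding semiminimal_family_def F by auto
qed

theorem proposition5p4:
  fixes A :: "('a, 'm) monoid_scheme"
    and H :: "('h, 'n) monoid_scheme"
    and \<alpha> :: "'h \<Rightarrow> 'a \<Rightarrow> 'a"
    and r :: "'i rel"
    and c :: "'i \<Rightarrow> 'a \<times> 'h"
  assumes "comm_group A"
    and "comm_group H"
    and "\<alpha> \<in> hom H (AutoGroup A)"
    and "semiminimal_family (semidirect_product A H \<alpha>) r c"
  shows "chromatic_number (cayley_graph (semidirect_product A H \<alpha>) (c ` Field r))
           \<le>o |{..<4::nat}| *c |\<alpha> ` carrier H|"
proof -
  define G where "G = semidirect_product A H \<alpha>"
  interpret A: comm_group A by fact
  interpret H: comm_group H by fact
  interpret G: group G unfolding G_def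
    by (rule group_semidirect_product[OF A.group_axioms H.group_axioms assms(3)])
  interpret Aut: group "AutoGroup A" by (rule A.AutoGroup)
  have G_carrier: "carrier G = carrier A \<times> carrier H"
    and G_mult: "\<And>a h b k. (a, h) \<otimes>\<^bsub>G\<^esub> (b, k) = (a \<otimes>\<^bsub>A\<^esub> \<alpha> h b, h \<otimes>\<^bsub>H\<^esub> k)"
    by (simp_all add: G_def semidirect_product_def)
  interpret act: group_hom G "AutoGroup A" "\<alpha> \<circ> snd"
  proof unfold_locales
    show "\<alpha> \<circ> snd \<in> hom G (AutoGroup A)"
      using assms(3) by (auto simp: hom_def G_carrier G_mult Pi_iff)
  qed
  define N where "N = kernel G (AutoGroup A) (\<alpha> \<circ> snd)"
  have N: "subgroup N G" unfolding N_def by (rule act.subgroup_kernel)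
  have N_iff: "x \<in> N \<longleftrightarrow> x \<in> carrier G \<and> \<alpha> (snd x) = \<one>\<^bsub>AutoGroup A\<^esub>" for x
    by (auto simp: N_def kernel_def)
  have comm: "comm_group (G\<lparr>carrier := N\<rparr>)"
  proof (rule group.group_comm_groupI)
    show "group (G\<lparr>carrier := N\<rparr>)" by (rule G.subgroup_imp_group[OF N])
    fix x y assume "x \<in> carrier (G\<lparr>carrier := N\<rparr>)" "y \<in> carrier (G\<lparr>carrier := N\<rparr>)"
    moreover have "\<one>\<^bsub>AutoGroup A\<^esub> b = b" if "b \<in> carrier A" for b
      using that by (simp add: AutoGroup_def BijGroup_def)
    ultimately show "x \<otimes>\<^bsub>G\<lparr>carrier := N\<rparr>\<^esub> y = y \<otimes>\<^bsub>G\<lparr>carrier := N\<rparr>\<^esub> x"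
      by (cases x; cases y) (auto simp: N_iff G_carrier G_mult A.m_comm H.m_comm)
  qed
  define J where "J = {i \<in> Field r. c i \<in> N}"
  have semimin: "semiminimal_family G r c" using assms(4) by (simp add: G_def)
  have C: "c ` Field r \<subseteq> carrier G" using semimin by (simp add: semiminimal_family_def)
  note J = semiminimal_family_subgroup[OF G.group_axioms semimin N J_def]
  obtain g where g: "proper_coloring (cayley_graph (G\<lparr>carrier := N\<rparr>) (c ` J)) g" "g ` N \<subseteq> {..<4::nat}"
    using abelian_cayley_four_coloring[OF comm J(1)] unfolding J(2) by auto
  obtain g' where g': "proper_coloring (cayley_graph G (c ` J)) g'" "g' ` carrier G \<subseteq> g ` N"
    using proper_coloring_extend_subgroup[OF G.group_axioms N _ g(1)] by (auto simp: J_def)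
  define f where "f x = (g' x, \<alpha> (snd x))" for x
  let ?X = "cayley_graph G (c ` Field r)"
  have "f x \<noteq> f y" if xy: "(x, y) \<in> snd ?X" for x y
  proof (cases "\<alpha> (snd x) = \<alpha> (snd y)")
    case True
    have c: "x \<in> carrier G" "y \<in> carrier G" "x \<noteq> y"
      and e: "inv\<^bsub>G\<^esub> x \<otimes>\<^bsub>G\<^esub> y \<in> c ` Field r \<union> m_inv G ` c ` Field r"
      using xy by (auto simp: cayley_graph_def)
    have d: "inv\<^bsub>G\<^esub> x \<otimes>\<^bsub>G\<^esub> y \<in> N"
    proof -
      have "(\<alpha> \<circ> snd) (inv\<^bsub>G\<^esub> x \<otimes>\<^bsub>G\<^esub> y) = inv\<^bsub>AutoGroup A\<^esub> (\<alpha> \<circ> snd) x \<otimes>\<^bsub>AutoGroup A\<^esub> (\<alpha> \<circ> snd) y"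
        using c act.hom_mult[of "inv\<^bsub>G\<^esub> x" y] act.hom_inv[of x] by simp
      also have "\<dots> = \<one>\<^bsub>AutoGroup A\<^esub>" using True c act.hom_closed[OF c(2)] by simp
      finally show ?thesis using c by (simp add: N_iff)
    qed
    have "inv\<^bsub>G\<^esub> x \<otimes>\<^bsub>G\<^esub> y \<in> c ` J \<union> m_inv G ` c ` J"
      using e
    proof
      assume "inv\<^bsub>G\<^esub> x \<otimes>\<^bsub>G\<^esub> y \<in> c ` Field r"
      thus ?thesis using d by (auto simp: J_def)
    next
      assume "inv\<^bsub>G\<^esub> x \<otimes>\<^bsub>G\<^esub> y \<in> m_inv G ` c ` Field r"
      then obtain i where i: "i \<in> Field r" "inv\<^bsub>G\<^esub> x \<otimes>\<^bsub>G\<^esub> y = inv\<^bsub>G\<^esub> c i" by blast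
      have "inv\<^bsub>G\<^esub> (inv\<^bsub>G\<^esub> c i) \<in> N" using d i(2) subgroup.m_inv_closed[OF N] by metis
      moreover have "c i \<in> carrier G" using C i(1) by auto
      ultimately have "i \<in> J" using i(1) by (simp add: J_def)
      thus ?thesis using i(2) by blast
    qed
    hence "(x, y) \<in> snd (cayley_graph G (c ` J))" using c by (simp add: cayley_graph_def)
    hence "g' x \<noteq> g' y" using g'(1) by (auto simp: proper_coloring_def)
    thus ?thesis by (simp add: f_def)
  qed (simp add: f_def)
  hence "proper_coloring ?X f" by (auto simp: proper_coloring_def)
  hence "chromatic_number ?X \<le>o |f ` fst ?X|"
    by (intro chromatic_number_le irrefl_cayley_graph) (auto simp: cayley_graph_def)
  also have "|f ` fst ?X| \<le>o |{..<4::nat} \<times> \<alpha> ` carrier H|"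
  proof (rule card_of_mono1)
    show "f ` fst ?X \<subseteq> {..<4} \<times> \<alpha> ` carrier H"
      using g'(2) g(2) by (force simp: f_def cayley_graph_def G_carrier)
  qed
  finally show ?thesis by (simp add: G_def cprod_def Field_card_of)
qed

end
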